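(* Let $N \ge K \ge r$ and let $A \in \mathbb{C}^{N \times r}$ be a matrix of rank $r$. Let $\widehat{A}$ be a dominant $K \times r$ submatrix of $A$, formed by the rows of $A$ with indices in a set $J \subset \{1,\dots,N\}$, $|J| = K$. Then there exists a matrix of coefficients $C \in \mathbb{C}^{N \times K}$ such that $A = C\widehat{A}$ and $$\forall i \in \{1,\dots,N\} \setminus J: \quad \Vert C_i \Vert_2 \le \sqrt{\frac{r}{K+1-r}},$$ where $C_i$ denotes the $i$-th row of $C$.
   Context: For a matrix $X \in \mathbb{C}^{K \times r}$ with $K \ge r$, its (rectangular) volume is $\mathrm{vol}(X) = \sqrt{\det(X^*X)}$. Let $N \ge K \ge r$ and let $A \in \mathbb{C}^{N \times r}$ be of full column rank. A $K \times r$ submatrix $\widehat{A}$ of $A$ (formed by $K$ rows of $A$) is called dominant if a swap of any single row of $\widehat{A}$ for a row of $A$ not already present in $\widehat{A}$ does not increase the volume.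
   Formalization: The dominant submatrix Â is additionally assumed to have nonzero volume; without this the claim fails, e.g. for A with rows (0,0), (0,0), (1,0), (0,1) and Â the first two rows, which is dominant but zero. *)

theory Defs
  imports
    Jordan_Normal_Form.Schur_Decomposition
    Jordan_Normal_Form.DL_Rank
    Jordan_Normal_Form.DL_Submatrix
    "HOL-Analysis.L2_Norm"
begin

(* The Gram determinant is a nonnegative real number, so taking the real part
   only changes its type. *)
definition vol :: "complex mat \<Rightarrow> real" where
  "vol X = sqrt (Re (det (mat_adjoint X * X)))"

definition vec_norm2 :: "complex vec \<Rightarrow> real" where
  "vec_norm2 v = L2_set (\<lambda>k. cmod (v $ k)) {..<dim_vec v}"

(* Rows are indexed from 0. *)
definition row_submatrix :: "complex mat \<Rightarrow> nat set \<Rightarrow> complex mat" where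
  "row_submatrix A J = submatrix A J UNIV"

(* Rows count as different when their indices differ, even if their entries agree.
   After a swap the rows are listed in increasing order of their indices again; this
   can permute them, which does not affect the volume.
   A submatrix of volume zero can be dominant in this sense: for the matrix with rows
   (0,0), (0,0), (1,0), (0,1) and J = {0, 1}, a single swap always leaves a zero row. *)
definition dominant :: "complex mat \<Rightarrow> nat set \<Rightarrow> bool" where
  "dominant A J \<longleftrightarrow>
     (\<forall>j \<in> J. \<forall>i \<in> {..<dim_row A} - J.
        vol (row_submatrix A (insert i (J - {j}))) \<le> vol (row_submatrix A J))"

end

theory Submission
  imports Defs
begin

text \<open>Let \<open>X\<close> be the dominant submatrix, \<open>G = X\<^sup>* X\<close> and \<open>H = G\<^sup>-\<^sup>1\<close>. The coefficients are
  \<open>C = A H X\<^sup>*\<close>. With \<open>P = A H A\<^sup>*\<close>, row \<open>i\<close> of \<open>C\<close> consists of the entries \<open>P\<^sub>i\<^sub>j\<close> with \<open>j \<in> J\<close>,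
  and \<open>C C\<^sup>* = P\<close> makes its squared norm equal to \<open>l\<^sub>i = P\<^sub>i\<^sub>i\<close>. Swapping row \<open>j\<close> of \<open>X\<close> for row \<open>i\<close>
  of \<open>A\<close> perturbs \<open>G\<close> by a matrix of rank two, which multiplies the squared volume by
  \<open>(1 + l\<^sub>i) (1 - l\<^sub>j) + |P\<^sub>i\<^sub>j|\<^sup>2\<close>; dominance says that this factor is at most 1. Summing over
  \<open>j \<in> J\<close>, where the \<open>l\<^sub>j\<close> add up to the trace \<open>r\<close> of \<open>H G\<close>, gives
  \<open>(1 + l\<^sub>i) (K - r) + l\<^sub>i \<le> K\<close>, which is the claim.\<close>

section \<open>Adjoints and determinant identities\<close>

lemma dim_mat_adjoint [simp]:
  "dim_row (mat_adjoint A) = dim_col A" "dim_col (mat_adjoint A) = dim_row A"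
  by (simp_all add: mat_adjoint_def)

lemma mat_adjoint_carrier [intro, simp]:
  "A \<in> carrier_mat m n \<Longrightarrow> mat_adjoint A \<in> carrier_mat n m"
  by (intro carrier_matI) simp_all

lemma index_mat_adjoint [simp]:
  fixes A :: "complex mat"
  assumes "i < dim_col A" and "j < dim_row A"
  shows "mat_adjoint A $$ (i, j) = cnj (A $$ (j, i))"
  using assms by (simp add: mat_adjoint_def mat_of_rows_index)

lemma mat_adjoint_adjoint [simp]:
  fixes A :: "complex mat"
  shows "mat_adjoint (mat_adjoint A) = A"
  by (rule eq_matI) auto

lemma mat_adjoint_mult:
  fixes A B :: "complex mat"
  assumes "A \<in> carrier_mat m n" and "B \<in> carrier_mat n k"
  shows "mat_adjoint (A * B) = mat_adjoint B * mat_adjoint A"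
  using assms by (intro eq_matI) (auto simp: scalar_prod_def mult.commute)

lemma mat_adjoint_one [simp]: "mat_adjoint (1\<^sub>m n :: complex mat) = 1\<^sub>m n"
  by (rule eq_matI) auto

lemma det_mat_2:
  assumes "A \<in> carrier_mat 2 2"
  shows "det A = A $$ (0, 0) * A $$ (1, 1) - A $$ (0, 1) * A $$ (1, 0)"
proof -
  have "det (mat_delete A 0 0) = A $$ (1, 1)" "det (mat_delete A 0 1) = A $$ (1, 0)"
    using assms by (auto simp: det_single mat_delete_def)
  then show ?thesis
    using assms by (subst laplace_expansion_row[OF assms, of 0])
      (simp_all add: numeral_2_eq_2 cofactor_def)
qed

text \<open>Both sides are the determinant of the block matrix with rows \<open>(G, -U)\<close> and \<open>(V, 1)\<close>,
  after block elimination of \<open>V\<close> and of \<open>-U\<close> respectively.\<close>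

lemma det_add_mult:
  fixes G :: "'a :: field mat"
  assumes G: "G \<in> carrier_mat n n" and H: "H \<in> carrier_mat n n" and GH: "G * H = 1\<^sub>m n"
    and U: "U \<in> carrier_mat n m" and V: "V \<in> carrier_mat m n"
  shows "det (G + U * V) = det G * det (1\<^sub>m m + V * H * U)"
proof -
  let ?M = "four_block_mat G (- U) V (1\<^sub>m m)"
  let ?L = "four_block_mat (1\<^sub>m n) (0\<^sub>m n m) (- V) (1\<^sub>m m)"
  let ?R = "four_block_mat (1\<^sub>m n) (H * U) (0\<^sub>m m n) (1\<^sub>m m)"
  have M: "?M \<in> carrier_mat (n + m) (n + m)"
    and L: "?L \<in> carrier_mat (n + m) (n + m)"
    and R: "?R \<in> carrier_mat (n + m) (n + m)"
    using G by auto
  have HU: "H * U \<in> carrier_mat n m" using H U by simp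
  have "- U * - V = U * V"
    using U V by (intro eq_matI) (auto simp: scalar_prod_def)
  moreover have "V + - V = 0\<^sub>m m n"
    using V by (intro eq_matI) auto
  moreover have "?M * ?L = four_block_mat (G * 1\<^sub>m n + - U * - V) (G * 0\<^sub>m n m + - U * 1\<^sub>m m)
      (V * 1\<^sub>m n + 1\<^sub>m m * - V) (V * 0\<^sub>m n m + 1\<^sub>m m * 1\<^sub>m m)"
    by (rule mult_four_block_mat[of _ n n _ m _ m _ _ n _ m])
      (use G U V in auto)
  ultimately have M_L: "?M * ?L = four_block_mat (G + U * V) (- U) (0\<^sub>m m n) (1\<^sub>m m)"
    using G U V by simp
  have "G * (H * U) = U"
    using U by (simp add: assoc_mult_mat[OF G H U, symmetric] GH)
  moreover have "U + - U = 0\<^sub>m n m"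
    using U by (intro eq_matI) auto
  moreover have "V * (H * U) + 1\<^sub>m m = 1\<^sub>m m + V * H * U"
    using V HU by (simp add: assoc_mult_mat[OF V H U] comm_add_mat[of "V * (H * U)" m m])
  moreover have "?M * ?R = four_block_mat (G * 1\<^sub>m n + - U * 0\<^sub>m m n) (G * (H * U) + - U * 1\<^sub>m m)
      (V * 1\<^sub>m n + 1\<^sub>m m * 0\<^sub>m m n) (V * (H * U) + 1\<^sub>m m * 1\<^sub>m m)"
    by (rule mult_four_block_mat[of _ n n _ m _ m _ _ n _ m])
      (use G U V HU in auto)
  ultimately have M_R: "?M * ?R = four_block_mat G (0\<^sub>m n m) V (1\<^sub>m m + V * H * U)"
    using G U V by simp
  have "det ?L = 1"
    using V by (simp add: det_four_block_mat_upper_right_zero[of _ n _ m])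
  then have "det ?M = det (?M * ?L)"
    by (simp add: det_mult[OF M L])
  also have "\<dots> = det (G + U * V)"
    using G U V by (simp add: M_L det_four_block_mat_lower_left_zero[of _ n _ m])
  finally have 1: "det ?M = det (G + U * V)" .
  have "det ?R = 1"
    using HU by (simp add: det_four_block_mat_lower_left_zero[of _ n _ m])
  then have "det ?M = det (?M * ?R)"
    by (simp add: det_mult[OF M R])
  also have "\<dots> = det G * det (1\<^sub>m m + V * H * U)"
    using G H U V by (simp add: M_R det_four_block_mat_upper_right_zero[of _ n _ m])
  finally show ?thesis using 1 by simp
qed

section \<open>Nonnegativity of Gram determinants\<close>

text \<open>For an eigenvector \<open>v\<close>, moving the adjoint across the inner product turns
  \<open>e\<close> times the squared norm of \<open>v\<close> into the squared norm of
  \<open>X *\<^sub>v v\<close>.\<close>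

lemma eigenvalue_gram_nonneg:
  fixes X :: "complex mat"
  assumes X: "X \<in> carrier_mat m n" and e: "eigenvalue (mat_adjoint X * X) e"
  shows "e \<ge> 0"
proof -
  from e X obtain v where v: "v \<in> carrier_vec n" "v \<noteq> 0\<^sub>v n"
    and ev: "mat_adjoint X * X *\<^sub>v v = e \<cdot>\<^sub>v v"
    unfolding eigenvalue_def eigenvector_def by auto
  have "(mat_adjoint X *\<^sub>v (X *\<^sub>v v)) \<bullet>c v = (X *\<^sub>v v) \<bullet>c (X *\<^sub>v v)"
  proof -
    have "(mat_adjoint X *\<^sub>v w) \<bullet>c v = w \<bullet>c (X *\<^sub>v v)" if w: "w \<in> carrier_vec m" for w
    proof -
      have "(mat_adjoint X *\<^sub>v w) \<bullet>c v
          = (\<Sum>p<n. \<Sum>k<m. cnj (X $$ (k, p)) * w $ k * cnj (v $ p))"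
        using X v w by (simp add: scalar_prod_def sum_distrib_right atLeast0LessThan)
      also have "\<dots> = (\<Sum>k<m. \<Sum>p<n. cnj (X $$ (k, p)) * w $ k * cnj (v $ p))"
        by (rule sum.swap)
      also have "\<dots> = w \<bullet>c (X *\<^sub>v v)"
        using X v w
        by (simp add: scalar_prod_def sum_distrib_left atLeast0LessThan mult_ac)
      finally show ?thesis .
    qed
    then show ?thesis using X v by simp
  qed
  moreover have "mat_adjoint X *\<^sub>v (X *\<^sub>v v) = e \<cdot>\<^sub>v v"
    using X v ev by (subst assoc_mult_mat_vec[symmetric]) auto
  ultimately have *: "e * (v \<bullet>c v) = (X *\<^sub>v v) \<bullet>c (X *\<^sub>v v)"
    using v by simp
  have "v \<bullet>c v > 0" "(X *\<^sub>v v) \<bullet>c (X *\<^sub>v v) \<ge> 0"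
    using v by auto
  \<comment> \<open>Both inner products are real, the one of \<open>v\<close> positive; hence
    \<open>e\<close> is real as well as nonnegative.\<close>
  with * show "e \<ge> 0"
    by (auto simp: less_complex_def less_eq_complex_def complex_eq_iff)
      (metis zero_le_mult_iff not_less)
qed

text \<open>Schur triangularization makes the determinant the product of the eigenvalues. The order
  on complex numbers also forces the determinant to be real, so the real part taken in
  \<open>vol\<close> loses nothing.\<close>

lemma det_gram_nonneg:
  fixes X :: "complex mat"
  shows "det (mat_adjoint X * X) \<ge> 0"
proof -
  let ?G = "mat_adjoint X * X" and ?n = "dim_col X"
  have X: "X \<in> carrier_mat (dim_row X) ?n" by simp
  then have G: "?G \<in> carrier_mat ?n ?n" by auto
  obtain es where es: "char_poly ?G = (\<Prod>e\<leftarrow>es. [:- e, 1:])"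
    using char_poly_factorized[OF G] by blast
  obtain B P Q where "schur_decomposition ?G es = (B, P, Q)"
    by (cases "schur_decomposition ?G es")
  from schur_decomposition[OF G es this]
  have sim: "similar_mat_wit ?G B P Q" and ut: "upper_triangular B" and diag: "diag_mat B = es"
    by auto
  have "similar_mat ?G B" using sim by (auto simp: similar_mat_def)
  moreover have "B \<in> carrier_mat ?n ?n"
    using similar_mat_witD2[OF G sim] by simp
  ultimately  have "det ?G = prod_list es"
    using det_similar det_upper_triangular[OF ut] diag by metis
  moreover have "\<forall>e \<in> set es. e \<ge> 0"
  proof
    fix e assume "e \<in> set es"
    then have "poly (char_poly ?G) e = 0"
      unfolding es by (induction es) auto
    then show "e \<ge> 0"
      using eigenvalue_gram_nonneg[OF X] eigenvalue_root_char_poly[OF G] by blast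
  qed
  then have "prod_list es \<ge> 0"
    by (induction es) (auto simp: less_eq_complex_def)
  ultimately show ?thesis by simp
qed

section \<open>Row submatrices and their Gram matrices\<close>

lemma row_submatrix_carrier:
  assumes "A \<in> carrier_mat N r" and "I \<subseteq> {..<N}"
  shows "row_submatrix A I \<in> carrier_mat (card I) r"
proof -
  have "{i. i < N \<and> i \<in> I} = I" using assms by auto
  then show ?thesis
    using assms(1) by (auto simp: row_submatrix_def submatrix_def)
qed

lemma index_row_submatrix:
  assumes "A \<in> carrier_mat N r" and "I \<subseteq> {..<N}" and "k < card I" and "q < r"
  shows "row_submatrix A I $$ (k, q) = A $$ (pick I k, q)"
proof -
  have "{i. i < N \<and> i \<in> I} = I" using assms by auto
  then show ?thesis
    using assms by (auto simp: row_submatrix_def submatrix_index pick_UNIV)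
qed

text \<open>Converts sums over row positions of a submatrix into sums over row indices of
  \<open>A\<close>. An index \<open>i\<close> sits at the position that counts the smaller elements
  of \<open>I\<close>.\<close>

lemma bij_betw_pick:
  assumes "finite I"
  shows "bij_betw (pick I) {..<card I} I"
proof (rule bij_betwI')
  fix x y assume "x \<in> {..<card I}" "y \<in> {..<card I}"
  then show "pick I x = pick I y \<longleftrightarrow> x = y"
    by (metis card_pick_le lessThan_iff)
next
  fix x assume "x \<in> {..<card I}"
  then show "pick I x \<in> I" by (simp add: pick_in_set_le)
next
  fix i assume i: "i \<in> I"
  then have "card {a \<in> I. a < i} < card I"
    using assms by (intro psubset_card_mono) auto
  then show "\<exists>x \<in> {..<card I}. i = pick I x"
    using pick_card_in_set[OF i] by (metis lessThan_iff)
qed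

text \<open>As a sum over an index set, the Gram matrix does not depend on the order of the rows, so
  a swap just adds one term and removes another.\<close>

lemma index_gram_row_submatrix:
  assumes A: "A \<in> carrier_mat N r" and I: "I \<subseteq> {..<N}" and "p < r" "q < r"
  shows "(mat_adjoint (row_submatrix A I) * row_submatrix A I) $$ (p, q)
    = (\<Sum>i\<in>I. cnj (A $$ (i, p)) * A $$ (i, q))"
proof -
  note X = row_submatrix_carrier[OF A I]
  have "(mat_adjoint (row_submatrix A I) * row_submatrix A I) $$ (p, q)
      = (\<Sum>k<card I. cnj (A $$ (pick I k, p)) * A $$ (pick I k, q))"
    using X assms by (simp add: scalar_prod_def atLeast0LessThan index_row_submatrix)
  also have "\<dots> = (\<Sum>i\<in>I. cnj (A $$ (i, p)) * A $$ (i, q))"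
    using bij_betw_pick[of I] I finite_subset
    by (intro sum.reindex_bij_betw) auto
  finally show ?thesis .
qed

section \<open>The effect of a row swap on the Gram determinant\<close>

lemma det_gram_swap:
  fixes A :: "complex mat"
  assumes A: "A \<in> carrier_mat N r" and J: "J \<subseteq> {..<N}"
    and i: "i < N" "i \<notin> J" and j: "j \<in> J"
    and H: "H \<in> carrier_mat r r" and H_adj: "mat_adjoint H = H"
    and G_def: "G = mat_adjoint (row_submatrix A J) * row_submatrix A J"
    and GH: "G * H = 1\<^sub>m r"
    and P_def: "P = A * H * mat_adjoint A"
    and X'_def: "X' = row_submatrix A (insert i (J - {j}))"
  shows "det (mat_adjoint X' * X')
    = det G * ((1 + P $$ (i, i)) * (1 - P $$ (j, j)) + P $$ (i, j) * cnj (P $$ (i, j)))"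
proof -
  \<comment> \<open>The columns of \<open>?U\<close> are the adjoint of row \<open>i\<close> and
    minus the adjoint of row \<open>j\<close>; the rows of \<open>?V\<close> are rows
    \<open>i\<close> and \<open>j\<close>. Their product is the change of the Gram matrix.\<close>
  let ?U = "mat r 2 (\<lambda>(p, y). if y = 0 then cnj (A $$ (i, p)) else - cnj (A $$ (j, p)))"
  let ?V = "mat 2 r (\<lambda>(x, q). A $$ (if x = 0 then i else j, q))"
  have jN: "j < N" using J j by auto
  have fin: "finite J" using J finite_subset by blast
  have J': "insert i (J - {j}) \<subseteq> {..<N}" using J i by auto
  have G: "G \<in> carrier_mat r r"
    using row_submatrix_carrier[OF A J] unfolding G_def
    by (meson mat_adjoint_carrier mult_carrier_mat)
  have "mat_adjoint X' * X' = G + ?U * ?V"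
  proof (rule eq_matI)
    fix p q assume "p < dim_row (G + ?U * ?V)" "q < dim_col (G + ?U * ?V)"
    then have pq: "p < r" "q < r" by auto
    let ?f = "\<lambda>i. cnj (A $$ (i, p)) * A $$ (i, q)"
    have "(mat_adjoint X' * X') $$ (p, q) = sum ?f (insert i (J - {j}))"
      unfolding X'_def by (rule index_gram_row_submatrix[OF A J' pq])
    also have "\<dots> = sum ?f J + ?f i - ?f j"
      using fin i j by (simp add: sum_diff1)
    finally show "(mat_adjoint X' * X') $$ (p, q) = (G + ?U * ?V) $$ (p, q)"
      using G pq index_gram_row_submatrix[OF A J pq]
      by (simp add: G_def[symmetric] scalar_prod_def numeral_2_eq_2)
  qed (use row_submatrix_carrier[OF A J'] in \<open>auto simp: X'_def\<close>)
  then have det_X': "det (mat_adjoint X' * X') = det G * det (1\<^sub>m 2 + ?V * H * ?U)"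
    by (simp add: det_add_mult[OF G H GH, where U = ?U and V = ?V])
  \<comment> \<open>Up to the sign of the second column, \<open>?V * H * ?U\<close> is the 2 by 2
    block of \<open>P\<close> at the indices \<open>i\<close> and \<open>j\<close>.\<close>
  have VHU: "(1\<^sub>m 2 + ?V * H * ?U) $$ (x, y)
      = (if x = y then 1 else 0)
        + (if y = 0 then 1 else - 1) * P $$ (if x = 0 then i else j, if y = 0 then i else j)"
    if "x < 2" "y < 2" for x y
    using that A H i jN
    by (auto simp: P_def scalar_prod_def sum_negf)
  \<comment> \<open>Hermitian symmetry turns the off-diagonal product into a squared modulus; the
    sign in \<open>?U\<close> makes it enter with a plus.\<close>
  have "mat_adjoint P = P"
  proof -
    have "mat_adjoint P = A * mat_adjoint (A * H)"
      using A H by (simp add: P_def mat_adjoint_mult[of "A * H" N r "mat_adjoint A" N])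
    also have "mat_adjoint (A * H) = H * mat_adjoint A"
      by (simp add: mat_adjoint_mult[OF A H] H_adj)
    finally show ?thesis
      using A H by (simp add: P_def assoc_mult_mat[of _ N r _ r _ N])
  qed
  then have "P $$ (j, i) = cnj (P $$ (i, j))"
    using index_mat_adjoint[of j P i] A i jN by (simp add: P_def)
  moreover have "1\<^sub>m 2 + ?V * H * ?U \<in> carrier_mat 2 2"
    by (rule carrier_matI) simp_all
  ultimately have "det (1\<^sub>m 2 + ?V * H * ?U)
      = (1 + P $$ (i, i)) * (1 - P $$ (j, j)) + P $$ (i, j) * cnj (P $$ (i, j))"
    by (simp add: det_mat_2 VHU del: index_add_mat)
  with det_X' show ?thesis by simp
qed

section \<open>The trace and the bound on the coefficient rows\<close>

text \<open>Cyclicity of the trace for rectangular factors, used to evaluate the sum of the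
  \<open>l j\<close> as the trace of an identity matrix of size \<open>r\<close>.\<close>

lemma sum_diag_mult_comm:
  fixes A B :: "'a :: comm_semiring_0 mat"
  assumes "A \<in> carrier_mat m n" and "B \<in> carrier_mat n m"
  shows "(\<Sum>k<m. (A * B) $$ (k, k)) = (\<Sum>p<n. (B * A) $$ (p, p))"
proof -
  have "(\<Sum>k<m. (A * B) $$ (k, k)) = (\<Sum>k<m. \<Sum>p<n. A $$ (k, p) * B $$ (p, k))"
    using assms by (simp add: scalar_prod_def atLeast0LessThan)
  also have "\<dots> = (\<Sum>p<n. \<Sum>k<m. A $$ (k, p) * B $$ (p, k))"
    by (rule sum.swap)
  also have "\<dots> = (\<Sum>p<n. (B * A) $$ (p, p))"
    using assms by (simp add: scalar_prod_def atLeast0LessThan mult.commute)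
  finally show ?thesis .
qed

theorem theorem4p2:
  fixes A :: "complex mat" and N K r :: nat and J :: "nat set"
  assumes "r \<le> K" and "K \<le> N"
    and "A \<in> carrier_mat N r"
    and "vec_space.rank N A = r"
    and "J \<subseteq> {..<N}" and "card J = K"
    and "dominant A J"
    and "vol (row_submatrix A J) \<noteq> 0"
  shows "\<exists>C \<in> carrier_mat N K. A = C * row_submatrix A J \<and>
           (\<forall>i \<in> {..<N} - J. vec_norm2 (row C i) \<le> sqrt (real r / (real K + 1 - real r)))"
proof -
  define X where "X = row_submatrix A J"
  define G where "G = mat_adjoint X * X"
  note A = assms(3) and J = assms(5)
  have X: "X \<in> carrier_mat K r"
    using row_submatrix_carrier[OF A J] assms(6) by (simp add: X_def)
  then have G: "G \<in> carrier_mat r r" by (auto simp: G_def)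
  have volX: "vol X = sqrt (Re (det G))" by (simp add: vol_def G_def)
  have "det G \<ge> 0" unfolding G_def by (rule det_gram_nonneg)
  \<comment> \<open>Nonzero volume excludes a zero determinant, so \<open>G\<close> is invertible
    and its determinant is a positive real.\<close>
  with assms(8) have detG: "Re (det G) > 0" "Im (det G) = 0"
    by (auto simp: volX X_def[symmetric] less_eq_complex_def)
  then have "det G \<noteq> 0" by auto
  from det_non_zero_imp_unit[OF G this] obtain H where
    H: "H \<in> carrier_mat r r" and HG: "H * G = 1\<^sub>m r" and GH: "G * H = 1\<^sub>m r"
    by (auto simp: Units_def ring_mat_simps)
  have H_adj: "mat_adjoint H = H"
  proof -
    have "mat_adjoint G = G"
      using X by (simp add: G_def mat_adjoint_mult[of _ r K _ r])
    \<comment> \<open>The adjoint of \<open>G * H = 1\<^sub>m r\<close> gives a left inverse of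
      \<open>G\<close>, which must agree with the right inverse \<open>H\<close>.\<close>
    then have "mat_adjoint H * G = 1\<^sub>m r"
      using arg_cong[OF GH, of mat_adjoint] by (simp add: mat_adjoint_mult[OF G H])
    then have "mat_adjoint H = mat_adjoint H * (G * H)"
      using H by (simp add: GH)
    also have "\<dots> = (mat_adjoint H * G) * H"
      using G H by (subst assoc_mult_mat) auto
    also have "\<dots> = H" using \<open>mat_adjoint H * G = 1\<^sub>m r\<close> H by simp
    finally show ?thesis .
  qed
  \<comment> \<open>\<open>H * mat_adjoint X\<close> is the Moore-Penrose inverse of
    \<open>X\<close>, so each row of \<open>C\<close> is the shortest coefficient vector producing
    that row of \<open>A\<close>.\<close>
  define C where "C = A * H * mat_adjoint X"
  define P where "P = A * H * mat_adjoint A"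
  have AH: "A * H \<in> carrier_mat N r" using A H by simp
  have C: "C \<in> carrier_mat N K" using AH X by (auto simp: C_def)
  have CX: "A = C * X"
  proof -
    have "C * X = A * H * G"
      using AH X by (simp add: C_def G_def assoc_mult_mat[of _ N r _ K _ r])
    also have "\<dots> = A"
      using A H G HG by (simp add: assoc_mult_mat[of _ N r _ r _ r])
    finally show ?thesis by simp
  qed
  have C_index: "C $$ (i, k) = P $$ (i, pick J k)" if "i < N" "k < K" for i k
  proof -
    have "pick J k < N" using that J assms(6) pick_in_set_le by blast
    then show ?thesis
      using that A H X J assms(6) 
      by (simp add: C_def P_def scalar_prod_def) (simp add: X_def index_row_submatrix[OF A J])
  qed
  have bij: "bij_betw (pick J) {..<K} J"
    using bij_betw_pick[of J] J assms(6) finite_subset by auto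
  \<comment> \<open>The adjoint of \<open>C\<close> begins with the factor \<open>X\<close>, and
    \<open>C * X\<close> collapses to \<open>A\<close>.\<close>
  have "C * mat_adjoint C = P"
  proof -
    have "mat_adjoint C = X * (mat_adjoint (A * H))"
      using X by (simp add: C_def mat_adjoint_mult[OF AH, of _ K])
    also have "mat_adjoint (A * H) = H * mat_adjoint A"
      by (simp add: mat_adjoint_mult[OF A H] H_adj)
    finally have "C * mat_adjoint C = C * X * (H * mat_adjoint A)"
      using C X H A by (subst assoc_mult_mat[of _ N K _ r _ N]) auto
    then show ?thesis
      using A H by (simp add: P_def CX[symmetric] assoc_mult_mat[of _ N r _ r _ N])
  qed
  then have P_diag: "P $$ (i, i) = of_real (\<Sum>j\<in>J. (cmod (P $$ (i, j)))\<^sup>2)" if "i < N" for i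
  proof -
    have "P $$ (i, i) = (\<Sum>k<K. C $$ (i, k) * cnj (C $$ (i, k)))"
      using C that by (simp flip: \<open>C * mat_adjoint C = P\<close> add: scalar_prod_def atLeast0LessThan)
    also have "\<dots> = (\<Sum>k<K. P $$ (i, pick J k) * cnj (P $$ (i, pick J k)))"
      using that by (simp add: C_index)
    also have "\<dots> = (\<Sum>j\<in>J. P $$ (i, j) * cnj (P $$ (i, j)))"
      by (rule sum.reindex_bij_betw[OF bij])
    finally show ?thesis by (simp only: complex_norm_square of_real_sum)
  qed
  \<comment> \<open>The squared norm of row \<open>i\<close> of \<open>C\<close> as a real number.
    For \<open>i\<close> in \<open>J\<close> it is the leverage score of that row in
    \<open>X\<close>.\<close>
  define l where "l i = (\<Sum>j\<in>J. (cmod (P $$ (i, j)))\<^sup>2)" for i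
  have P_l: "P $$ (i, i) = of_real (l i)" if "i < N" for i
    using P_diag[OF that] by (simp add: l_def)
  \<comment> \<open>On the indices in \<open>J\<close>, \<open>P\<close> is the orthogonal
    projection \<open>X * H * mat_adjoint X\<close> onto the column space of \<open>X\<close>, whose
    trace is its rank.\<close>
  have trace: "(\<Sum>j\<in>J. l j) = real r"
  proof -
    have "complex_of_real (\<Sum>j\<in>J. l j) = (\<Sum>j\<in>J. P $$ (j, j))"
      using J by (auto simp: P_l intro!: sum.cong)
    also have "\<dots> = (\<Sum>k<K. P $$ (pick J k, pick J k))"
      by (rule sum.reindex_bij_betw[OF bij, symmetric])
    also have "\<dots> = (\<Sum>k<K. (X * (H * mat_adjoint X)) $$ (k, k))"
    proof (rule sum.cong)
      fix k assume "k \<in> {..<K}"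
      then have k: "k < K" "pick J k < N" using J assms(6) pick_in_set_le by blast+
      have "P $$ (pick J k, pick J k) = (A * H * mat_adjoint X) $$ (pick J k, k)"
        using C_index[OF k(2,1)] by (simp add: C_def)
      also have "A * H * mat_adjoint X = A * (H * mat_adjoint X)"
        using A H X by (intro assoc_mult_mat) auto
      also have "\<dots> $$ (pick J k, k) = (X * (H * mat_adjoint X)) $$ (k, k)"
        using k A H X assms(6) by (simp add: scalar_prod_def) 
          (simp add: X_def index_row_submatrix[OF A J])
      finally show "P $$ (pick J k, pick J k) = (X * (H * mat_adjoint X)) $$ (k, k)" .
    qed simp
    also have "\<dots> = (\<Sum>p<r. (H * mat_adjoint X * X) $$ (p, p))"
      using X H by (intro sum_diag_mult_comm) auto
    also have "H * mat_adjoint X * X = 1\<^sub>m r"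
      using X H HG by (simp add: G_def assoc_mult_mat[of _ r r _ K _ r])
    also have "(\<Sum>p<r. (1\<^sub>m r :: complex mat) $$ (p, p)) = complex_of_real (real r)"
      by simp
    finally show ?thesis by (simp only: of_real_eq_iff)
  qed
  have bound: "l i \<le> real r / (real K + 1 - real r)" if i: "i < N" "i \<notin> J" for i
  proof -
    have "(1 + l i) * (1 - l j) + (cmod (P $$ (i, j)))\<^sup>2 \<le> 1" if j: "j \<in> J" for j
    proof -
      let ?X' = "row_submatrix A (insert i (J - {j}))"
      let ?t = "(1 + l i) * (1 - l j) + (cmod (P $$ (i, j)))\<^sup>2"
      have jN: "j < N" using j J by auto
      have "det (mat_adjoint ?X' * ?X') = det G * of_real ?t"
        using det_gram_swap[OF A J i j H H_adj G_def[unfolded X_def] GH P_def refl]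
        by (simp add: P_l i jN complex_norm_square del: of_real_power)
      then have "vol ?X' = sqrt (Re (det G) * ?t)"
        by (simp add: vol_def)
      moreover have "vol ?X' \<le> vol X"
        using assms(7) A i j by (auto simp: dominant_def X_def)
      \<comment> \<open>\<open>sqrt\<close> is strictly increasing on all reals, so the volumes
        compare as their arguments do, whatever the sign of \<open>?t\<close>.\<close>
      ultimately have "Re (det G) * ?t \<le> Re (det G) * 1"
        by (simp add: volX)
      then show ?thesis
        using detG(1) by (simp only: mult_le_cancel_left_pos)
    qed
    then have "(\<Sum>j\<in>J. (1 + l i) * (1 - l j) + (cmod (P $$ (i, j)))\<^sup>2) \<le> (\<Sum>j\<in>J. 1)"
      by (rule sum_mono)
    \<comment> \<open>The squared moduli add up to \<open>l i\<close> by its definition; this extra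
      term raises the final denominator from \<open>K - r\<close> to
      \<open>K + 1 - r\<close>.\<close>
    then have "(1 + l i) * (real K - real r) + l i \<le> real K"
      by (simp add: sum.distrib sum_distrib_left[symmetric] sum_subtractf trace assms(6))
        (simp add: l_def)
    then have "l i * (real K + 1 - real r) \<le> real r"
      by (simp add: algebra_simps)
    \<comment> \<open>Since \<open>r \<le> K\<close>, the divisor is at least 1, also in the square
      case \<open>K = r\<close>.\<close>
    then show ?thesis
      using assms(1) by (simp add: pos_le_divide_eq)
  qed
  have "vec_norm2 (row C i) \<le> sqrt (real r / (real K + 1 - real r))" if i: "i < N" "i \<notin> J" for i
  proof -
    have "(\<Sum>k<K. (cmod (C $$ (i, k)))\<^sup>2) = (\<Sum>k<K. (cmod (P $$ (i, pick J k)))\<^sup>2)"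
      using i by (simp add: C_index)
    also have "\<dots> = l i"
      unfolding l_def by (rule sum.reindex_bij_betw[OF bij])
    finally have "vec_norm2 (row C i) = sqrt (l i)"
      using C i by (simp add: vec_norm2_def L2_set_def)
    then show ?thesis using bound[OF i] by simp
  qed
  then show ?thesis
    using C CX by (auto simp: X_def)
qed

end
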